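(* Let $d\ge 2$ and let $\mu$ be a signed Radon measure on $\mathbf{R}^d\setminus\{0\}$ (i.e. $\mu\in M_{\mathrm{loc}}(\mathbf{R}^d\setminus\{0\})$) such that $\mu$ has finite total variation on $\mathbf{R}^d\setminus B_\varepsilon$ for every $\varepsilon>0$, where $B_\varepsilon=\{x:|x|\le\varepsilon\}$. Let $Q$ be a closed cone in $\mathbf{R}^d$ such that $Q\setminus\{0\}$ is contained in some open halfspace $\{x\in\mathbf{R}^d: x\cdot\omega_0>0\}$, $\omega_0\in S^{d-1}$. Assume that $\operatorname{supp}\mu\subset Q$ and that $\mu(H_{\omega,p})=0$ for almost all halfspaces $H_{\omega,p}$ whose closure $\overline{H_{\omega,p}}$ is contained in $\mathbf{R}^d\setminus\{0\}$. Then $\mu=0$.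
   Context: For $\omega\in S^{d-1}$ and $p\in\mathbf{R}$, $H_{\omega,p}=\{x\in\mathbf{R}^d: x\cdot\omega<p\}$; its closure lies in $\mathbf{R}^d\setminus\{0\}$ iff $p<0$. "Almost all halfspaces" means for almost all $(\omega,p)$ with respect to the product of surface measure on $S^{d-1}$ and Lebesgue measure on $\mathbf{R}$. A set $Q\subset\mathbf{R}^d$ is a cone if $x\in Q$ implies $\lambda x\in Q$ for all $\lambda>0$. $M_{\mathrm{loc}}(\Omega)$ denotes real linear forms $\mu$ on compactly supported continuous functions on the open set $\Omega$ satisfying $|\langle\mu,\varphi\rangle|\le C_K\sup|\varphi|$ for all $\varphi$ supported in a compact $K\subset\Omega$ (signed Radon measures on $\Omega$). *)

theory Defs
  imports "HOL-Analysis.Analysis"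
begin

definition halfspace :: "'a::euclidean_space \<Rightarrow> real \<Rightarrow> 'a set" where
  "halfspace \<omega> p = {x. x \<bullet> \<omega> < p}"

definition is_cone :: "'a::real_vector set \<Rightarrow> bool" where
  "is_cone Q \<longleftrightarrow> (\<forall>x\<in>Q. \<forall>c::real. c > 0 \<longrightarrow> c *\<^sub>R x \<in> Q)"

text \<open>Null sets for (surface measure on S^{d-1}) x (Lebesgue measure on R).
  Surface measure is defined as usual through Lebesgue measure of the truncated
  cone: sigma(E) = d * lambda({t w. 0 < t <= 1, w in E}).  Accordingly
  N (a subset of S^{d-1} x R) is null for sigma x lambda iff its truncated cone
  {(t w, p). 0 < t <= 1, (w,p) in N} is Lebesgue null in R^d x R.\<close>
definition trunc_cone :: "('a::euclidean_space \<times> real) set \<Rightarrow> ('a \<times> real) set" where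
  "trunc_cone N = (\<lambda>(t, \<omega>, p). (t *\<^sub>R \<omega>, p)) ` ({0<..1::real} \<times> N)"

definition sphere_line_null :: "('a::euclidean_space \<times> real) set \<Rightarrow> bool" where
  "sphere_line_null N \<longleftrightarrow> N \<subseteq> sphere 0 1 \<times> UNIV \<and> trunc_cone N \<in> null_sets lborel"

definition ae_halfspaces :: "('a::euclidean_space \<Rightarrow> real \<Rightarrow> bool) \<Rightarrow> bool" where
  "ae_halfspaces P \<longleftrightarrow>
     (\<exists>N. sphere_line_null N \<and> (\<forall>\<omega>\<in>sphere 0 1. \<forall>p. (\<omega>, p) \<notin> N \<longrightarrow> P \<omega> p))"

text \<open>A signed Radon measure mu on R^d - {0} with finite total variation outside
  every ball B_eps is represented as mu = M1 - M2 with M1, M2 positive Borel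
  measures on R^d that are finite on {x. eps <= |x|} for all eps > 0 (e.g. the
  Jordan decomposition).  Its values are only taken on Borel sets bounded away
  from 0, where they are finite.\<close>
definition away_from_0 :: "'a::real_normed_vector set \<Rightarrow> bool" where
  "away_from_0 A \<longleftrightarrow> (\<exists>\<epsilon>>0. \<forall>x\<in>A. \<epsilon> \<le> norm x)"

definition vanishes_on :: "'a::euclidean_space measure \<Rightarrow> 'a measure \<Rightarrow> 'a set \<Rightarrow> bool" where
  "vanishes_on M1 M2 U \<longleftrightarrow>
     (\<forall>A\<in>sets borel. A \<subseteq> U \<and> away_from_0 A \<longrightarrow> emeasure M1 A = emeasure M2 A)"

definition signed_supp :: "'a::euclidean_space measure \<Rightarrow> 'a measure \<Rightarrow> 'a set" where
  "signed_supp M1 M2 = (UNIV - {0}) - \<Union>{U. open U \<and> U \<subseteq> UNIV - {0} \<and> vanishes_on M1 M2 U}"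

end

theory Submission
  imports Defs
begin

text \<open>
  Write a point \<open>x\<close> of \<open>Q - {0}\<close> as \<open>w / t\<close> with \<open>t = 1 / (x \<bullet> \<omega>0) > 0\<close> and \<open>w \<bullet> \<omega>0 = 1\<close>;
  since \<open>Q\<close> is closed, \<open>w\<close> stays in a compact set. In these projective coordinates the origin becomes
  \<open>t = \<infinity>\<close>, infinity becomes \<open>t = 0\<close>, and the halfspace \<open>x \<bullet> v > 1\<close> becomes the sublevel set
  \<open>t < w \<bullet> v\<close>, so that the measure has finite variation on \<open>{t < c}\<close> for every \<open>c\<close> and vanishes on every set
  \<open>{t < a + w \<bullet> z}\<close>. Hence it annihilates \<open>(max 0 (a + w \<bullet> z - t)) ^ m\<close> for all \<open>m \<ge> 1\<close>.
  Differentiating in \<open>z\<close> lowers the exponent and produces factors \<open>w \<bullet> v\<close>; as \<open>m\<close> is arbitrary, the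
  measure annihilates \<open>q w * max 0 (c - t)\<close> for every polynomial \<open>q\<close>, and by Stone-Weierstrass it is zero.
\<close>

subsection \<open>Measures on a half cylinder\<close>

text \<open>A point is a pair (t, w). The slice t = 0 corresponds to infinity and is kept so that
  the set is closed. The second coordinate ranges over a ball of the full space, which avoids
  choosing coordinates on the hyperplane where w really lives.\<close>

definition half_cylinder :: "real \<Rightarrow> (real \<times> 'a::real_normed_vector) set" where
  "half_cylinder R = {0..} \<times> cball 0 R"

text \<open>This is the domination condition for all limits below: \<open>B\<close> times the
  indicator of t < \<open>c\<close> is integrable for both measures of the locale. The bound is
  asked for only on the half cylinder, where both measures live almost everywhere.\<close>

definition tame :: "real \<Rightarrow> real \<Rightarrow> real \<Rightarrow> (real \<times> 'a::euclidean_space \<Rightarrow> real) \<Rightarrow> bool" where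
  "tame R c B f \<longleftrightarrow> f \<in> borel_measurable borel \<and>
     (\<forall>y\<in>half_cylinder R. \<bar>f y\<bar> \<le> B * indicator {y. fst y < c} y)"

lemma below_borel: "{y :: real \<times> 'a::euclidean_space. fst y < c} \<in> sets borel"
  by (intro borel_open open_Collect_less continuous_intros)

text \<open>The two measures are the positive and the negative part of one signed measure, and
  equality between them replaces vanishing of their difference. Mass may be infinite as t tends to
  infinity, that is, near the origin of the original space.\<close>

locale cylinder_pair =
  fixes P1 P2 :: "(real \<times> 'a::euclidean_space) measure" and R :: real
  assumes sets_P: "sets P1 = sets borel" "sets P2 = sets borel"
    and supported: "AE y in P1. y \<in> half_cylinder R" "AE y in P2. y \<in> half_cylinder R"
    and finite_below: "\<And>c. emeasure P1 {y. fst y < c} < \<infinity>" "\<And>c. emeasure P2 {y. fst y < c} < \<infinity>"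
    and sublevel_eq: "\<And>a z. emeasure P1 {y. fst y < a + snd y \<bullet> z} = emeasure P2 {y. fst y < a + snd y \<bullet> z}"
begin

text \<open>By this symmetry a fact proved for \<open>P1\<close> alone can be read off for
  \<open>P2\<close>.\<close>

lemma swapped: "cylinder_pair P2 P1 R"
  by unfold_locales (rule sets_P supported finite_below sublevel_eq[symmetric])+

definition same_integral :: "(real \<times> 'a \<Rightarrow> real) \<Rightarrow> bool" where
  "same_integral f \<longleftrightarrow> integral\<^sup>L P1 f = integral\<^sup>L P2 f"

lemma borel_P: "f \<in> borel_measurable borel \<Longrightarrow> f \<in> borel_measurable P1"
  by (simp add: measurable_cong_sets[OF sets_P(1) refl])

lemma integrable_below: "integrable P1 (\<lambda>y. B * indicator {y. fst y < c} y :: real)"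
  by (intro integrable_mult_right integrable_real_indicator)
     (simp_all only: finite_below sets_P below_borel)

lemma tame_integrable1:
  assumes "tame R c B f"
  shows "integrable P1 f"
proof (rule Bochner_Integration.integrable_bound[OF integrable_below[of B c]])
  show "f \<in> borel_measurable P1"
    using assms by (auto simp: tame_def intro: borel_P)
  show "AE y in P1. norm (f y) \<le> norm (B * indicator {y. fst y < c} y :: real)"
    using supported(1) by eventually_elim (use assms in \<open>force simp: tame_def\<close>)
qed

lemma tame_limit1:
  assumes "\<And>n. tame R c B (f n)"
    and "g \<in> borel_measurable borel"
    and "\<And>y. y \<in> half_cylinder R \<Longrightarrow> (\<lambda>n. f n y) \<longlonglongrightarrow> g y"
  shows "(\<lambda>n. integral\<^sup>L P1 (f n)) \<longlonglongrightarrow> integral\<^sup>L P1 g"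
proof (rule integral_dominated_convergence)
  show "g \<in> borel_measurable P1" "\<And>n. f n \<in> borel_measurable P1"
    using assms by (auto simp: tame_def intro: borel_P)
  show "AE y in P1. (\<lambda>n. f n y) \<longlonglongrightarrow> g y"
    using supported(1) by eventually_elim (use assms in auto)
  show "AE y in P1. norm (f n y) \<le> B * indicator {y. fst y < c} y" for n
    using supported(1) by eventually_elim (use assms in \<open>auto simp: tame_def\<close>)
qed (rule integrable_below)

lemmas tame_integrable = tame_integrable1 cylinder_pair.tame_integrable1[OF swapped]

text \<open>Dominated convergence applies to both measures, and limits are unique. One pair
  \<open>c\<close>, \<open>B\<close> has to serve all \<open>n\<close>.\<close>

lemma same_integral_limit:
  assumes "\<And>n. tame R c B (f n)" "\<And>n. same_integral (f n)"
    and "g \<in> borel_measurable borel"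
    and "\<And>y. y \<in> half_cylinder R \<Longrightarrow> (\<lambda>n. f n y) \<longlonglongrightarrow> g y"
  shows "same_integral g"
  using tame_limit1[OF assms(1,3,4)] cylinder_pair.tame_limit1[OF swapped assms(1,3,4)] assms(2)
  unfolding same_integral_def by (auto intro: LIMSEQ_unique)

text \<open>Tameness gives integrability, without which the integral need not be additive. The
  factor \<open>k\<close> is there for difference quotients.\<close>

lemma same_integral_diff:
  assumes "tame R c B f" "tame R c' B' g" "same_integral f" "same_integral g"
  shows "same_integral (\<lambda>y. k * (f y - g y))"
  using assms tame_integrable[OF assms(1)] tame_integrable[OF assms(2)]
  unfolding same_integral_def by simp

lemma same_integral_add:
  assumes "tame R c B f" "tame R c' B' g" "same_integral f" "same_integral g"
  shows "same_integral (\<lambda>y. f y + g y)"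
  using assms tame_integrable[OF assms(1)] tame_integrable[OF assms(2)]
  unfolding same_integral_def by simp

text \<open>Both measures have the same image under s = a + w . z - t: the rays s > x pull back to
  sublevel sets, which have equal mass, finite because w . z is at most \<open>R * norm z\<close> on
  the half cylinder. If \<open>f\<close> is not integrable, both integrals take the default value
  0.\<close>

lemma same_integral_ridge:
  fixes f :: "real \<Rightarrow> real"
  assumes [measurable]: "f \<in> borel_measurable borel"
  shows "same_integral (\<lambda>y. f (a + snd y \<bullet> z - fst y))"
proof -
  let ?s = "\<lambda>y::real\<times>'a. a + snd y \<bullet> z - fst y"
  have s: "?s \<in> borel_measurable borel"
    by (intro borel_measurable_continuous_onI continuous_intros)
  have s1: "?s \<in> measurable P1 borel" "?s \<in> measurable P2 borel"
    using s by (simp_all add: measurable_cong_sets[OF sets_P(1) refl] measurable_cong_sets[OF sets_P(2) refl])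
  have em: "emeasure (distr P1 borel ?s) {x<..} = emeasure P1 {y. fst y < (a - x) + snd y \<bullet> z}"
       "emeasure (distr P2 borel ?s) {x<..} = emeasure P2 {y. fst y < (a - x) + snd y \<bullet> z}" for x
    using s1 by (auto simp: emeasure_distr sets_eq_imp_space_eq[OF sets_P(1)]
         sets_eq_imp_space_eq[OF sets_P(2)] intro!: arg_cong2[where f=emeasure])
  have fin: "emeasure P1 {y. fst y < b + snd y \<bullet> z} < \<infinity>" for b
  proof -
    have "emeasure P1 {y. fst y < b + snd y \<bullet> z} \<le> emeasure P1 {y. fst y < b + R * norm z}"
    proof (rule emeasure_mono_AE)
      show "AE y in P1. y \<in> {y. fst y < b + snd y \<bullet> z} \<longrightarrow> y \<in> {y. fst y < b + R * norm z}"
        using supported(1)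
      proof eventually_elim
        case (elim y)
        have "snd y \<bullet> z \<le> norm (snd y) * norm z" by (rule norm_cauchy_schwarz)
        also have "\<dots> \<le> R * norm z"
          using elim by (auto simp: half_cylinder_def intro!: mult_right_mono)
        finally show ?case by auto
      qed
    qed (simp_all only: sets_P below_borel)
    then show ?thesis using finite_below(1) le_less_trans by blast
  qed
  have "distr P1 borel ?s = distr P2 borel ?s"
    by (rule measure_eqI_lessThan) (simp_all only: em fin[unfolded sublevel_eq] sublevel_eq sets_distr)
  then have "integral\<^sup>L (distr P1 borel ?s) f = integral\<^sup>L (distr P2 borel ?s) f" by simp
  then show ?thesis
    using s1 by (simp add: integral_distr same_integral_def)
qed

end

section \<open>Truncated powers and their bounds on the half cylinder\<close>

text \<open>Away from 0 the function is locally constant 0 or an ordinary power. At 0 the difference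
  quotient is at most \<open>|h| ^ m\<close> in absolute value, which tends to 0 because m >=
  1.\<close>

lemma max0_power_has_derivative:
  fixes x :: real
  assumes "m \<ge> 1"
  shows "((\<lambda>x. max 0 x ^ Suc m) has_real_derivative real (Suc m) * max 0 x ^ m) (at x)"
proof (cases x "0::real" rule: linorder_cases)
  case less
  have "((\<lambda>x. 0) has_real_derivative real (Suc m) * max 0 x ^ m) (at x)"
    using less assms by (simp add: power_0_left)
  then show ?thesis
    by (rule has_field_derivative_transform_within_open[where S="{..<0}"]) (use less in auto)
next
  case greater
  have "((\<lambda>x. x ^ Suc m) has_real_derivative real (Suc m) * x ^ m) (at x)"
    by (auto intro!: derivative_eq_intros simp del: power_Suc)
  then have "((\<lambda>x. x ^ Suc m) has_real_derivative real (Suc m) * max 0 x ^ m) (at x)"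
    using greater by simp
  then show ?thesis
    by (rule has_field_derivative_transform_within_open[where S="{0<..}"]) (use greater in auto)
next
  case equal
  have "((\<lambda>h::real. max 0 h ^ Suc m / h) \<longlongrightarrow> 0) (at 0)"
  proof (rule Lim_null_comparison)
    have "norm (max 0 h ^ Suc m / h) \<le> \<bar>h\<bar> ^ m" for h :: real
      by (auto simp: max_def)
    then show "\<forall>\<^sub>F h in at 0. norm (max 0 h ^ Suc m / h) \<le> \<bar>h\<bar> ^ m" by simp
    have "((\<lambda>h::real. \<bar>h\<bar> ^ m) \<longlongrightarrow> \<bar>0\<bar> ^ m) (at 0)" by (intro tendsto_intros)
    then show "((\<lambda>h::real. \<bar>h\<bar> ^ m) \<longlongrightarrow> 0) (at 0)" using assms by (simp add: power_0_left)
  qed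
  then show ?thesis using equal assms by (simp add: DERIV_def power_0_left)
qed

text \<open>The difference of powers factors into a difference of truncations, and truncation is
  1-Lipschitz, times a sum of m + 1 terms, each at most \<open>M ^ m\<close>. The explicit constant
  dominates difference quotients uniformly in the step size.\<close>

lemma max0_power_lipschitz:
  fixes x y M :: real
  assumes "x \<le> M" "y \<le> M" "0 \<le> M"
  shows "\<bar>max 0 x ^ Suc m - max 0 y ^ Suc m\<bar> \<le> real (Suc m) * M ^ m * \<bar>x - y\<bar>"
proof -
  let ?x = "max 0 x" and ?y = "max 0 y"
  have "\<bar>\<Sum>i<Suc m. ?y ^ (Suc m - Suc i) * ?x ^ i\<bar> \<le> (\<Sum>i<Suc m. M ^ m)"
  proof (rule order_trans[OF sum_abs], rule sum_mono)
    fix i assume i: "i \<in> {..<Suc m}"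
    have "\<bar>?y ^ (Suc m - Suc i) * ?x ^ i\<bar> \<le> M ^ (m - i) * M ^ i"
      unfolding abs_mult using assms by (intro mult_mono) (auto intro!: power_mono simp: power_abs[symmetric])
    also have "\<dots> = M ^ m" using i by (simp flip: power_add)
    finally show "\<bar>?y ^ (Suc m - Suc i) * ?x ^ i\<bar> \<le> M ^ m" .
  qed
  then have A: "\<bar>\<Sum>i<Suc m. ?y ^ (Suc m - Suc i) * ?x ^ i\<bar> \<le> real (Suc m) * M ^ m" by simp
  have B: "\<bar>?x - ?y\<bar> \<le> \<bar>x - y\<bar>" by auto
  have "?x ^ Suc m - ?y ^ Suc m = (?x - ?y) * (\<Sum>i<Suc m. ?y ^ (Suc m - Suc i) * ?x ^ i)"
    by (rule power_diff_sumr2)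
  then have "\<bar>?x ^ Suc m - ?y ^ Suc m\<bar> = \<bar>?x - ?y\<bar> * \<bar>\<Sum>i<Suc m. ?y ^ (Suc m - Suc i) * ?x ^ i\<bar>"
    by (simp only: abs_mult)
  also have "\<dots> \<le> \<bar>x - y\<bar> * (real (Suc m) * M ^ m)"
    by (intro mult_mono A B) auto
  finally show ?thesis by (simp add: mult_ac)
qed

lemma inner_le_on_half_cylinder:
  assumes "y \<in> half_cylinder R" shows "\<bar>snd y \<bullet> z\<bar> \<le> R * norm z"
proof -
  have "\<bar>snd y \<bullet> z\<bar> \<le> norm (snd y) * norm z" by (rule Cauchy_Schwarz_ineq2)
  also have "\<dots> \<le> R * norm z"
    using assms by (auto simp: half_cylinder_def intro!: mult_right_mono)
  finally show ?thesis .
qed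

lemma real_polynomial_function_bounded:
  fixes q :: "'a::euclidean_space \<Rightarrow> real"
  assumes "real_polynomial_function q"
  obtains B where "B \<ge> 0" "\<And>y. y \<in> half_cylinder R \<Longrightarrow> \<bar>q (snd y)\<bar> \<le> B"
proof -
  have "compact (q ` cball 0 R)"
    using assms by (intro compact_continuous_image continuous_on_polymonial_function)
       (auto simp: real_polynomial_function_eq)
  then obtain B where B: "\<And>w. w \<in> cball 0 R \<Longrightarrow> \<bar>q w\<bar> \<le> B"
    using compact_imp_bounded bounded_iff by (metis imageI real_norm_def)
  show thesis
    \<comment> \<open>For negative \<open>R\<close> the ball is empty and \<open>B\<close> could be
      negative, hence the maximum.\<close>
    by (rule that[of "max B 0"]) (use B in \<open>fastforce simp: half_cylinder_def\<close>)+
qed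

lemma real_polynomial_function_measurable:
  "real_polynomial_function q \<Longrightarrow> q \<in> borel_measurable borel"
  for q :: "'a::euclidean_space \<Rightarrow> real"
  by (intro borel_measurable_continuous_onI continuous_on_polymonial_function)
     (auto simp: real_polynomial_function_eq)

text \<open>On the half cylinder a + w . z is at most \<open>c\<close>, so the truncated power is 0
  once t >= \<open>c\<close> (here m >= 1 gives 0 ^ m = 0), and since t >= 0 its base never exceeds
  \<open>c\<close> below that.\<close>

lemma tame_ridge:
  fixes q :: "'a::euclidean_space \<Rightarrow> real"
  assumes "q \<in> borel_measurable borel" "m \<ge> 1" "B \<ge> 0" "\<And>y. y \<in> half_cylinder R \<Longrightarrow> \<bar>q (snd y)\<bar> \<le> B"
    and c: "\<bar>a\<bar> + R * norm z \<le> c"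
  shows "tame R c (B * c ^ m) (\<lambda>y. q (snd y) * max 0 (a + snd y \<bullet> z - fst y) ^ m)"
  unfolding tame_def
proof (intro conjI ballI)
  have [measurable]: "q \<in> borel_measurable borel" by fact
  show "(\<lambda>y. q (snd y) * max 0 (a + snd y \<bullet> z - fst y) ^ m) \<in> borel_measurable borel"
    unfolding borel_prod[symmetric] by measurable
  fix y :: "real \<times> 'a" assume y: "y \<in> half_cylinder R"
  have b: "a + snd y \<bullet> z \<le> c" using inner_le_on_half_cylinder[OF y, of z] c by auto
  have t: "fst y \<ge> 0" using y by (auto simp: half_cylinder_def)
  show "\<bar>q (snd y) * max 0 (a + snd y \<bullet> z - fst y) ^ m\<bar> \<le> B * c ^ m * indicator {y. fst y < c} y"
  proof (cases "fst y < c")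
    case True
    then have "\<bar>max 0 (a + snd y \<bullet> z - fst y) ^ m\<bar> \<le> c ^ m"
      using b t by (auto simp: power_abs[symmetric] intro!: power_mono)
    then have "\<bar>q (snd y)\<bar> * \<bar>max 0 (a + snd y \<bullet> z - fst y) ^ m\<bar> \<le> B * c ^ m"
      using assms(3) assms(4)[OF y] by (intro mult_mono) auto
    then show ?thesis using True by (simp add: abs_mult)
  next
    case False
    then have "max 0 (a + snd y \<bullet> z - fst y) = 0" using b by auto
    then show ?thesis using assms(2) False by (simp add: power_0_left)
  qed
qed

section \<open>Polynomial weights in w\<close>

context cylinder_pair
begin

text \<open>All exponents \<open>m \<ge> 1\<close> are needed: multiplying \<open>q\<close> by a linear form costs one power.\<close>

definition determined :: "('a \<Rightarrow> real) \<Rightarrow> bool" where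
  "determined q \<longleftrightarrow> (\<forall>m\<ge>1. \<forall>a z. same_integral (\<lambda>y. q (snd y) * max 0 (a + snd y \<bullet> z - fst y) ^ m))"

lemma determined_add:
  assumes p: "real_polynomial_function p" and q: "real_polynomial_function q"
    and "determined p" "determined q"
  shows "determined (\<lambda>w. p w + q w)"
  unfolding determined_def
proof (intro allI impI)
  fix m a z assume m: "(1::nat) \<le> m"
  obtain B where B: "B \<ge> 0" "\<And>y. y \<in> half_cylinder R \<Longrightarrow> \<bar>p (snd y)\<bar> \<le> B"
    using real_polynomial_function_bounded[OF p] by blast
  obtain B' where B': "B' \<ge> 0" "\<And>y. y \<in> half_cylinder R \<Longrightarrow> \<bar>q (snd y)\<bar> \<le> B'"
    using real_polynomial_function_bounded[OF q] by blast
  show "same_integral (\<lambda>y. (p (snd y) + q (snd y)) * max 0 (a + snd y \<bullet> z - fst y) ^ m)"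
    unfolding distrib_right
    by (rule same_integral_add
          [OF tame_ridge[OF real_polynomial_function_measurable[OF p] m B order_refl]
              tame_ridge[OF real_polynomial_function_measurable[OF q] m B' order_refl]])
       (use assms(3,4) m in \<open>auto simp: determined_def\<close>)
qed

lemma determined_scale: "determined q \<Longrightarrow> determined (\<lambda>w. k * q w)"
  by (auto simp: determined_def same_integral_def mult.assoc)

text \<open>The derivative of \<open>max 0 (a + w \<bullet> z - t) ^ Suc m\<close> with respect to
  \<open>z\<close> in direction \<open>v\<close> is (m + 1) (w . v) times the m-th power. The
  difference quotients have equal integrals by the hypothesis for exponent m + 1, and dominated
  convergence passes this to the derivative.\<close>

lemma determined_times_inner:
  assumes q: "real_polynomial_function q" and dq: "determined q"
  shows "determined (\<lambda>w. (w \<bullet> v) * q w)"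
  unfolding determined_def
proof (intro allI impI)
  fix m a z assume m: "(1::nat) \<le> m"
  note [measurable] = real_polynomial_function_measurable[OF q]
  obtain B where B: "B \<ge> 0" "\<And>y. y \<in> half_cylinder R \<Longrightarrow> \<bar>q (snd y)\<bar> \<le> B"
    using real_polynomial_function_bounded[OF q] by blast
  define h where "h n = inverse (real (Suc n))" for n
  have h: "h n > 0" "h n \<le> 1" for n by (auto simp: h_def divide_simps)
  define g where "g s y = q (snd y) * max 0 (a + snd y \<bullet> (z + s *\<^sub>R v) - fst y) ^ Suc m"
    for s and y :: "real \<times> 'a"
  \<comment> \<open>The extra factor 1 / (m + 1) makes the difference quotients converge to the
    target function itself.\<close>
  define f where "f n y = inverse (real (Suc m) * h n) * (g (h n) y - g 0 y)" for n y
  \<comment> \<open>\<open>c\<close> controls every shift z + s v with 0 <= s <= 1, which is why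
    \<open>h n\<close> is at most 1. In \<open>K\<close> the factor \<open>B\<close> bounds q,
    \<open>c ^ m\<close> comes from the Lipschitz constant, and the last factor bounds w . v; m + 1
    and \<open>h n\<close> cancel against the normalisation of \<open>f\<close>.\<close>
  define c where "c = \<bar>a\<bar> + \<bar>R\<bar> * (norm z + norm v)"
  define K where "K = B * c ^ m * (\<bar>R\<bar> * norm v)"
  have c: "c \<ge> 0" by (auto simp: c_def)
  have cb: "\<bar>a\<bar> + R * norm (z + s *\<^sub>R v) \<le> c" if "0 \<le> s" "s \<le> 1" for s
  proof -
    have "norm (z + s *\<^sub>R v) \<le> norm z + norm v"
      using that norm_triangle_ineq[of z "s *\<^sub>R v"] mult_right_mono[of s 1 "norm v"] by auto
    then have "R * norm (z + s *\<^sub>R v) \<le> \<bar>R\<bar> * (norm z + norm v)"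
      by (intro mult_mono) auto
    then show ?thesis by (simp add: c_def)
  qed
  have g: "tame R c (B * c ^ Suc m) (g s)" if "0 \<le> s" "s \<le> 1" for s
    unfolding g_def
    by (rule tame_ridge) (use B cb[OF that] in auto)
  have sg: "same_integral (g s)" for s
    using dq unfolding determined_def g_def by (auto simp del: power_Suc)
  show "same_integral (\<lambda>y. ((snd y \<bullet> v) * q (snd y)) * max 0 (a + snd y \<bullet> z - fst y) ^ m)"
  proof (rule same_integral_limit)
    show "same_integral (f n)" for n
      unfolding f_def
      by (rule same_integral_diff[OF g g sg sg]) (use h[of n] in auto)
    show "tame R c K (f n)" for n
      unfolding tame_def
    proof (intro conjI ballI)
      show "f n \<in> borel_measurable borel"
        unfolding f_def using g[of "h n"] g[of 0] h[of n]
        by (auto simp: tame_def intro!: borel_measurable_times borel_measurable_diff)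
      fix y :: "real \<times> 'a" assume y: "y \<in> half_cylinder R"
      have t: "fst y \<ge> 0" using y by (auto simp: half_cylinder_def)
      let ?x = "a + snd y \<bullet> (z + h n *\<^sub>R v) - fst y" and ?x' = "a + snd y \<bullet> (z + 0 *\<^sub>R v) - fst y"
      have x: "?x \<le> c - fst y" "?x' \<le> c - fst y"
        using inner_le_on_half_cylinder[OF y, of "z + h n *\<^sub>R v"] cb[of "h n"] h[of n]
              inner_le_on_half_cylinder[OF y, of "z + 0 *\<^sub>R v"] cb[of 0] by auto
      show "\<bar>f n y\<bar> \<le> K * indicator {y. fst y < c} y"
      proof (cases "fst y < c")
        case False
        then have z: "max 0 ?x = 0" "max 0 ?x' = 0" using x by auto
          have "f n y = 0" unfolding f_def g_def z by simp
        then show ?thesis using False by simp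
      next
        case True
        have "\<bar>g (h n) y - g 0 y\<bar> = \<bar>q (snd y)\<bar> * \<bar>max 0 ?x ^ Suc m - max 0 ?x' ^ Suc m\<bar>"
          by (simp only: g_def abs_mult[symmetric] right_diff_distrib)
        also have "\<dots> \<le> B * (real (Suc m) * c ^ m * \<bar>?x - ?x'\<bar>)"
          using x t c B y by (intro mult_mono max0_power_lipschitz) auto
        also have "?x - ?x' = h n * (snd y \<bullet> v)" by (simp add: inner_simps)
        also have "\<bar>h n * (snd y \<bullet> v)\<bar> = h n * \<bar>snd y \<bullet> v\<bar>" using h[of n] by (simp add: abs_mult)
        also have "B * (real (Suc m) * c ^ m * (h n * \<bar>snd y \<bullet> v\<bar>)) \<le>
            B * (real (Suc m) * c ^ m * (h n * (\<bar>R\<bar> * norm v)))"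
          using inner_le_on_half_cylinder[OF y, of v] B c h[of n] mult_right_mono[OF abs_ge_self[of R] norm_ge_zero[of v]]
          by (intro mult_left_mono) auto
        also have "\<dots> = K * (real (Suc m) * h n)" by (simp add: K_def mult_ac)
        finally have "\<bar>g (h n) y - g 0 y\<bar> \<le> K * (real (Suc m) * h n)" .
        moreover have r: "real (Suc m) * h n > 0" using h[of n] by simp
        ultimately have "\<bar>g (h n) y - g 0 y\<bar> / (real (Suc m) * h n) \<le> K"
          by (simp only: pos_divide_le_eq)
        moreover have "\<bar>f n y\<bar> = \<bar>g (h n) y - g 0 y\<bar> / (real (Suc m) * h n)"
          unfolding f_def abs_mult[of "inverse _"] abs_inverse abs_of_pos[OF r]
          by (simp only: divide_inverse mult.commute)
        ultimately show ?thesis using True by simp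
      qed
    qed
    show "(\<lambda>y. ((snd y \<bullet> v) * q (snd y)) * max 0 (a + snd y \<bullet> z - fst y) ^ m) \<in> borel_measurable borel"
      unfolding borel_prod[symmetric] by measurable
    fix y :: "real \<times> 'a" assume y: "y \<in> half_cylinder R"
    let ?G = "\<lambda>s. max 0 (a + snd y \<bullet> z - fst y + s * (snd y \<bullet> v)) ^ Suc m"
    have "((\<lambda>s. ?G s) has_real_derivative
        (real (Suc m) * max 0 (a + snd y \<bullet> z - fst y + 0 * (snd y \<bullet> v)) ^ m) * (snd y \<bullet> v)) (at 0)"
      by (rule DERIV_chain2[OF max0_power_has_derivative[OF m]]) (auto intro!: derivative_eq_intros)
    then have D: "((\<lambda>s. (?G s - ?G 0) / s) \<longlongrightarrow>
        (real (Suc m) * max 0 (a + snd y \<bullet> z - fst y) ^ m) * (snd y \<bullet> v)) (at 0)"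
      by (simp add: DERIV_def del: power_Suc)
    have "filterlim h (at 0) sequentially"
      unfolding filterlim_at using h LIMSEQ_inverse_real_of_nat
      by (auto simp: h_def[abs_def])
    from filterlim_compose[OF D this]
    have "(\<lambda>n. q (snd y) / real (Suc m) * ((?G (h n) - ?G 0) / h n)) \<longlonglongrightarrow>
        q (snd y) / real (Suc m) * ((real (Suc m) * max 0 (a + snd y \<bullet> z - fst y) ^ m) * (snd y \<bullet> v))"
      by (rule tendsto_mult_left)
    moreover have "f n y = q (snd y) / real (Suc m) * ((?G (h n) - ?G 0) / h n)" for n
    proof -
      have e: "a + snd y \<bullet> (z + s *\<^sub>R v) - fst y = a + snd y \<bullet> z - fst y + s * (snd y \<bullet> v)" for s
        by (simp add: inner_simps)
      show ?thesis
        unfolding f_def g_def e right_diff_distrib[symmetric]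
        by (simp only: divide_inverse inverse_mult_distrib mult_ac)
    qed
    ultimately show "(\<lambda>n. f n y) \<longlonglongrightarrow> ((snd y \<bullet> v) * q (snd y)) * max 0 (a + snd y \<bullet> z - fst y) ^ m"
      by (simp add: mult_ac)
  qed
qed

lemma determined_one: "determined (\<lambda>w. 1)"
  unfolding determined_def by (auto intro!: same_integral_ridge)

text \<open>The induction needs an arbitrary second factor \<open>q\<close>: for a product, f * (g *
  q) is handled by using the two induction hypotheses one after the other.\<close>

lemma determined_polynomial_mult:
  assumes "real_polynomial_function p" "real_polynomial_function q" "determined q"
  shows "determined (\<lambda>w. p w * q w)"
  using assms
proof (induction p arbitrary: q rule: real_polynomial_function.induct)
  case (linear f)
  \<comment> \<open>Riesz representation of the linear functional turns multiplication by it into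
    the case of an inner product.\<close>
  have "f w = w \<bullet> adjoint f 1" for w
    using adjoint_works[of f w 1] linear(1) by (simp add: bounded_linear.linear)
  then show ?case using determined_times_inner[OF linear(2,3)] by simp
next
  case (const c)
  then show ?case by (intro determined_scale)
next
  case (add f g)
  then show ?case
    unfolding distrib_right by (intro determined_add real_polynomial_function.intros(4)) auto
next
  case (mult f g)
  then show ?case
    unfolding mult.assoc by (intro mult.IH real_polynomial_function.intros(4)) auto
qed

lemma determined_polynomial:
  assumes "real_polynomial_function p" shows "determined p"
  using determined_polynomial_mult[OF assms real_polynomial_function.intros(2) determined_one] by simp

section \<open>From polynomial weights to equality of the measures\<close>

text \<open>Polynomials approximate \<open>u\<close> uniformly on the ball by Stone-Weierstrass, and
  max 0 (c - t) is the truncated power with z = 0 and exponent 1.\<close>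

lemma same_integral_continuous:
  fixes u :: "'a \<Rightarrow> real"
  assumes u: "continuous_on UNIV u"
  shows "same_integral (\<lambda>y. u (snd y) * max 0 (c - fst y))"
proof -
  have um [measurable]: "u \<in> borel_measurable borel"
    using u by (rule borel_measurable_continuous_onI)
  have "compact (u ` cball 0 R)"
    by (intro compact_continuous_image) (auto intro: continuous_on_subset[OF u])
  then obtain B where B: "\<And>w. w \<in> cball 0 R \<Longrightarrow> \<bar>u w\<bar> \<le> B"
    using compact_imp_bounded bounded_iff by (metis imageI real_norm_def)
  have "\<exists>p. real_polynomial_function p \<and> (\<forall>w\<in>cball 0 R. \<bar>u w - p w\<bar> < inverse (real (Suc n)))" for n
    using Stone_Weierstrass_real_polynomial_function[OF compact_cball[of 0 R] continuous_on_subset[OF u]]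
    by (metis inverse_positive_iff_positive of_nat_0_less_iff subset_UNIV zero_less_Suc)
  then obtain p where p: "\<And>n. real_polynomial_function (p n)"
    and pu: "\<And>n w. w \<in> cball 0 R \<Longrightarrow> \<bar>u w - p n w\<bar> < inverse (real (Suc n))"
    by metis
  show ?thesis
  proof (rule same_integral_limit)
    show "same_integral (\<lambda>y. p n (snd y) * max 0 (c + snd y \<bullet> 0 - fst y) ^ 1)" for n
      using determined_polynomial[OF p[of n]] by (auto simp only: determined_def)
    \<comment> \<open>The approximation error is at most 1, so B + 1 bounds every \<open>p n\<close>
      on the ball.\<close>
    show "tame R \<bar>c\<bar> (max 0 (B + 1) * \<bar>c\<bar> ^ 1)
        (\<lambda>y. p n (snd y) * max 0 (c + snd y \<bullet> 0 - fst y) ^ 1)" for n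
    proof (rule tame_ridge)
      fix y :: "real \<times> 'a" assume "y \<in> half_cylinder R"
      then have w: "snd y \<in> cball 0 R" by (auto simp: half_cylinder_def)
      have "inverse (real (Suc n)) \<le> 1" by (simp add: divide_simps)
      then show "\<bar>p n (snd y)\<bar> \<le> max 0 (B + 1)" using pu[OF w, of n] B[OF w] by linarith
    qed (use p real_polynomial_function_measurable in auto)
    show "(\<lambda>y. u (snd y) * max 0 (c - fst y)) \<in> borel_measurable borel"
      unfolding borel_prod[symmetric] by measurable
    fix y :: "real \<times> 'a" assume "y \<in> half_cylinder R"
    then have w: "snd y \<in> cball 0 R" by (auto simp: half_cylinder_def)
    have "(\<lambda>n. p n (snd y)) \<longlonglongrightarrow> u (snd y)"
    proof (rule LIM_zero_cancel, rule Lim_null_comparison[OF _ LIMSEQ_inverse_real_of_nat])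
      show "\<forall>\<^sub>F n in sequentially. norm (p n (snd y) - u (snd y)) \<le> inverse (real (Suc n))"
        using pu[OF w] by (auto intro!: always_eventually simp: abs_minus_commute less_imp_le)
    qed
    then show "(\<lambda>n. p n (snd y) * max 0 (c + snd y \<bullet> 0 - fst y) ^ 1) \<longlonglongrightarrow> u (snd y) * max 0 (c - fst y)"
      by (auto intro!: tendsto_intros)
  qed
qed

text \<open>The indicator of t < c is the left derivative in c of max 0 (c - t). Its difference
  quotients lie between 0 and 1 and, for each t, are eventually equal to the limit.\<close>

lemma same_integral_below:
  fixes u :: "'a \<Rightarrow> real"
  assumes u: "continuous_on UNIV u"
  shows "same_integral (\<lambda>y. u (snd y) * indicator {..<c} (fst y))"
proof -
  have um [measurable]: "u \<in> borel_measurable borel"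
    using u by (rule borel_measurable_continuous_onI)
  have "compact (u ` cball 0 R)"
    by (intro compact_continuous_image) (auto intro: continuous_on_subset[OF u])
  then obtain B where B: "\<And>w. w \<in> cball 0 R \<Longrightarrow> \<bar>u w\<bar> \<le> B"
    using compact_imp_bounded bounded_iff by (metis imageI real_norm_def)
  define g where "g s y = u (snd y) * max 0 (s - fst y)" for s and y :: "real \<times> 'a"
  \<comment> \<open>The quotient is taken to the left of \<open>c\<close>: it vanishes for t >= c,
    so the limit is the indicator of the strict inequality. A right quotient would give 1 at t =
    c.\<close>
  define f where "f n y = real (Suc n) * (g c y - g (c - inverse (real (Suc n))) y)" for n y
  have gm: "g s \<in> borel_measurable borel" for s
    unfolding g_def borel_prod[symmetric] by measurable
  have g: "\<exists>c B. tame R c B (g s)" for s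
  proof -
    have "tame R \<bar>s\<bar> (max 0 B * \<bar>s\<bar> ^ 1) (\<lambda>y. u (snd y) * max 0 (s + snd y \<bullet> 0 - fst y) ^ 1)"
      by (rule tame_ridge) (use B in \<open>fastforce simp: half_cylinder_def\<close>)+
    then show ?thesis by (auto simp: g_def[abs_def])
  qed
  show ?thesis
  proof (rule same_integral_limit)
    show "same_integral (f n)" for n
      using g[of c] g[of "c - inverse (real (Suc n))"] same_integral_continuous[OF u]
      unfolding f_def by (auto intro!: same_integral_diff simp: g_def[abs_def])
    show "tame R c B (f n)" for n
      unfolding tame_def
    proof (intro conjI ballI)
      show "f n \<in> borel_measurable borel"
        unfolding f_def by (intro borel_measurable_times borel_measurable_diff gm) auto
      fix y :: "real \<times> 'a" assume y: "y \<in> half_cylinder R"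
      let ?i = "inverse (real (Suc n))" and ?t = "fst y"
      have i: "?i > 0" "real (Suc n) * ?i = 1" by auto
      show "\<bar>f n y\<bar> \<le> B * indicator {y. fst y < c} y"
      proof (cases "?t < c")
        case True
        have "\<bar>max 0 (c - ?t) - max 0 (c - ?i - ?t)\<bar> \<le> ?i" using i(1) by linarith
        then have "real (Suc n) * \<bar>max 0 (c - ?t) - max 0 (c - ?i - ?t)\<bar> \<le> 1"
          by (simp add: field_simps)
        then have "\<bar>u (snd y)\<bar> * (real (Suc n) * \<bar>max 0 (c - ?t) - max 0 (c - ?i - ?t)\<bar>) \<le> B * 1"
          using B[of "snd y"] y by (intro mult_mono) (auto simp: half_cylinder_def)
        moreover have "f n y = u (snd y) * (real (Suc n) * (max 0 (c - ?t) - max 0 (c - ?i - ?t)))"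
          by (simp only: f_def g_def right_diff_distrib mult_ac)
        ultimately show ?thesis using True by (simp only: abs_mult) simp
      next
        case False
        then have z: "max 0 (c - ?t) = 0" "max 0 (c - ?i - ?t) = 0" using i(1) by linarith+
        have "f n y = 0" unfolding f_def g_def z by simp
        then show ?thesis using False by simp
      qed
    qed
    show "(\<lambda>y. u (snd y) * indicator {..<c} (fst y)) \<in> borel_measurable borel"
      unfolding borel_prod[symmetric] by measurable
    fix y :: "real \<times> 'a" assume y: "y \<in> half_cylinder R"
    show "(\<lambda>n. f n y) \<longlonglongrightarrow> u (snd y) * indicator {..<c} (fst y)"
    proof (rule tendsto_eventually)
      show "\<forall>\<^sub>F n in sequentially. f n y = u (snd y) * indicator {..<c} (fst y)"
      proof (cases "fst y < c")
        case True
        then have "\<forall>\<^sub>F n in sequentially. inverse (real (Suc n)) < c - fst y"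
          by (intro order_tendstoD(2)[OF LIMSEQ_inverse_real_of_nat]) auto
        then show ?thesis
        proof eventually_elim
          case (elim n)
          then have "max 0 (c - fst y) - max 0 (c - inverse (real (Suc n)) - fst y) = inverse (real (Suc n))"
            using True by simp
          then have "f n y = real (Suc n) * (u (snd y) * inverse (real (Suc n)))"
            by (simp only: f_def g_def right_diff_distrib[symmetric])
          then show ?case using True by simp
        qed
      next
        case False
        have z: "max 0 (c - fst y) = 0" "max 0 (c - inverse (real (Suc n)) - fst y) = 0" for n
        proof -
          have "inverse (real (Suc n)) > 0" by simp
          then show "max 0 (c - fst y) = 0" "max 0 (c - inverse (real (Suc n)) - fst y) = 0"
            using False by linarith+
        qed
        have "f n y = 0" for n unfolding f_def g_def z by simp
        then show ?thesis using False by simp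
      qed
    qed
  qed
qed

lemma same_integral_rect:
  fixes C :: "'a set"
  assumes C: "closed C" "C \<noteq> {}"
  shows "same_integral (\<lambda>y. indicator C (snd y) * indicator {..<c} (fst y))"
proof (rule same_integral_limit)
  \<comment> \<open>These continuous functions decrease to the indicator of \<open>C\<close> because
    \<open>C\<close> is closed. Nonemptiness matters: \<open>infdist\<close> to the empty set is 0
    by convention.\<close>
  define u where "u n w = max 0 (1 - real n * infdist w C)" for n w
  have cu: "continuous_on UNIV (u n)" for n
    unfolding u_def by (intro continuous_intros)
  note [measurable] = borel_measurable_continuous_onI[OF cu]
  have u: "\<bar>u n w\<bar> \<le> 1" for n w using infdist_nonneg[of w C] by (auto simp: u_def)
  show "same_integral (\<lambda>y. u n (snd y) * indicator {..<c} (fst y))" for n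
    by (rule same_integral_below[OF cu])
  show "tame R c 1 (\<lambda>y. u n (snd y) * indicator {..<c} (fst y))" for n
    unfolding tame_def
  proof
    show "(\<lambda>y. u n (snd y) * indicator {..<c} (fst y)) \<in> borel_measurable borel"
      unfolding borel_prod[symmetric] by measurable
  qed (use u in \<open>auto simp: indicator_def\<close>)
  have [measurable]: "C \<in> sets borel" using C by simp
  show "(\<lambda>y. indicator C (snd y) * indicator {..<c} (fst y) :: real) \<in> borel_measurable borel"
    unfolding borel_prod[symmetric] by measurable
  fix y :: "real \<times> 'a"
  have "(\<lambda>n. u n (snd y)) \<longlonglongrightarrow> indicator C (snd y)"
  proof (cases "snd y \<in> C")
    case True
    then show ?thesis by (simp add: u_def)
  next
    case False
    then have d: "infdist (snd y) C > 0"
      using in_closed_iff_infdist_zero[OF C] infdist_nonneg[of "snd y" C] by fastforce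
    then obtain N :: nat where N: "1 / infdist (snd y) C < real N" using reals_Archimedean2 by blast
    have "\<forall>\<^sub>F n in sequentially. u n (snd y) = 0"
    proof (rule eventually_sequentiallyI)
      fix n assume "N \<le> n"
      then have "1 / infdist (snd y) C < real n" using N by linarith
      then show "u n (snd y) = 0" using d by (simp add: u_def field_simps)
    qed
    then show ?thesis using False by (simp add: tendsto_eventually)
  qed
  then show "(\<lambda>n. u n (snd y) * indicator {..<c} (fst y)) \<longlonglongrightarrow> indicator C (snd y) * indicator {..<c} (fst y)"
    by (intro tendsto_intros)
qed

lemma emeasure_rect_eq:
  assumes C: "closed C"
  shows "emeasure P1 ({..<c} \<times> C) = emeasure P2 ({..<c} \<times> C)"
proof (cases "C = {}")
  case False
  have rect: "{..<c} \<times> C \<in> sets P1" "{..<c} \<times> C \<in> sets P2"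
    using C unfolding sets_P borel_prod[symmetric] by auto
  have sub: "{..<c} \<times> C \<subseteq> {y. fst y < c}" by auto
  have fin: "emeasure P1 ({..<c} \<times> C) < \<infinity>" "emeasure P2 ({..<c} \<times> C) < \<infinity>"
    using le_less_trans[OF emeasure_mono[OF sub] finite_below(1)]
      le_less_trans[OF emeasure_mono[OF sub] finite_below(2)]
    by (simp_all only: sets_P below_borel)
  have "indicator C (snd y) * indicator {..<c} (fst y) = (indicator ({..<c} \<times> C) y :: real)" for y
    by (auto simp: indicator_def mem_Times_iff)
  then have "same_integral (indicator ({..<c} \<times> C))"
    using same_integral_rect[OF C False, of c] by simp
  then have "measure P1 ({..<c} \<times> C) = measure P2 ({..<c} \<times> C)"
    using rect fin by (simp add: same_integral_def)
  then show ?thesis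
    using fin by (simp add: emeasure_eq_ennreal_measure less_top)
qed simp

text \<open>The sets \<open>{..<c} \<times> C\<close> with \<open>C\<close> closed are stable under
  intersection and generate the Borel sets, and the strips t < n exhaust the space with finite
  mass.\<close>

theorem measures_equal: "P1 = P2"
proof (rule measure_eqI_generator_eq)
  let ?E = "{a \<times> b | a b. a \<in> range lessThan \<and> b \<in> Collect closed} :: (real \<times> 'a) set set"
  have "sets (borel \<Otimes>\<^sub>M borel :: (real \<times> 'a) measure) =
      sets (sigma (space borel \<times> space borel) ?E)"
  proof (rule sets_pair_eq)
    show "sets (borel :: real measure) = sigma_sets (space borel) (range lessThan)"
      by (subst borel_Iio) (auto intro: sets_measure_of)
    show "sets (borel :: 'a measure) = sigma_sets (space borel) (Collect closed)"
      by (subst borel_eq_closed) (auto intro: sets_measure_of)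
    show "countable (range (\<lambda>n. lessThan (real n)))" "countable {UNIV :: 'a set}" by auto
    show "\<Union> (range (\<lambda>n. lessThan (real n))) = space borel"
      by (auto intro: reals_Archimedean2)
  qed auto
  then have E: "sets borel = sigma_sets UNIV ?E"
    unfolding borel_prod by simp
  show "sets P1 = sigma_sets UNIV ?E" "sets P2 = sigma_sets UNIV ?E"
    using E by (simp_all add: sets_P)
  show "Int_stable ?E"
  proof (rule Int_stableI, safe)
    fix a c :: real and b d :: "'a set" assume "closed b" "closed d"
    then show "\<exists>a' b'. {..<a} \<times> b \<inter> {..<c} \<times> d = a' \<times> b' \<and> a' \<in> range lessThan \<and> b' \<in> Collect closed"
      by (intro exI[of _ "{..<min a c}"] exI[of _ "b \<inter> d"]) (auto simp: closed_Int)
  qed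
  show "emeasure P1 X = emeasure P2 X" if "X \<in> ?E" for X
    using that emeasure_rect_eq by auto
  show "range (\<lambda>n. {..<real n} \<times> UNIV) \<subseteq> ?E" by auto
  show "(\<Union>n. {..<real n} \<times> UNIV) = (UNIV :: (real \<times> 'a) set)"
    by (auto intro: reals_Archimedean2)
  have "{..<real n} \<times> UNIV = {y :: real \<times> 'a. fst y < real n}" for n by auto
  then show "emeasure P1 ({..<real n} \<times> UNIV) \<noteq> \<infinity>" for n
    using finite_below(1)[of "real n"] by simp
qed auto

end

subsection \<open>Measures away from the origin\<close>

text \<open>Off the support \<open>A\<close> is covered by open sets on which the measures agree. By
  Lindelof countably many suffice; making them disjoint splits \<open>A\<close> into pieces whose
  masses agree and sum to that of \<open>A\<close>.\<close>

lemma emeasure_eq_off_support: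
  fixes M1 M2 :: "'a::euclidean_space measure"
  assumes sets: "sets M1 = sets borel" "sets M2 = sets borel"
    and supp: "signed_supp M1 M2 \<subseteq> Q"
    and A: "A \<in> sets borel" "away_from_0 A" "A \<inter> Q = {}"
  shows "emeasure M1 A = emeasure M2 A"
proof -
  define F where "F = {U :: 'a set. open U \<and> U \<subseteq> UNIV - {0} \<and> vanishes_on M1 M2 U}"
  have "0 \<notin> A" using A(2) by (force simp: away_from_0_def)
  moreover have "signed_supp M1 M2 = UNIV - {0} - \<Union>F"
    by (simp add: signed_supp_def F_def)
  ultimately have AF: "A \<subseteq> \<Union>F"
    using supp A(3) by blast
  obtain F' where F': "F' \<subseteq> F" "countable F'" "\<Union>F' = \<Union>F"
    by (rule Lindelof[of F]) (auto simp: F_def)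
  \<comment> \<open>Adding the empty set guarantees that the countable family to be enumerated is
    nonempty.\<close>
  have "{} \<in> F" by (auto simp: F_def vanishes_on_def)
  define U where "U = from_nat_into (insert {} F')"
  have rU: "range U = insert {} F'"
    unfolding U_def by (rule range_from_nat_into) (use F' in auto)
  have UF: "U n \<in> F" for n using rangeI[of U n] F'(1) \<open>{} \<in> F\<close> unfolding rU by auto
  have Uo: "U n \<in> sets borel" for n using UF[of n] by (auto simp: F_def)
  define D where "D n = A \<inter> disjointed U n" for n
  have Db: "range D \<subseteq> sets borel"
    using A(1) Uo sets.range_disjointed_sets[of U borel] by (auto simp: D_def)
  have dD: "disjoint_family D"
    using disjoint_family_disjointed[of U] by (auto simp: D_def disjoint_family_on_def)
  have "(\<Union>n. U n) = \<Union>F" unfolding rU using F'(3) by simp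
  then have uD: "(\<Union>n. D n) = A"
    using AF by (simp add: D_def UN_disjointed_eq Int_absorb2 flip: Int_UN_distrib)
  have "emeasure M1 (D n) = emeasure M2 (D n)" for n
  proof -
    have "D n \<subseteq> U n" using disjointed_subset[of U n] by (auto simp: D_def)
    moreover have "away_from_0 (D n)"
      using A(2) by (auto simp: D_def away_from_0_def)
    ultimately show ?thesis
      using UF[of n] Db by (auto simp: F_def vanishes_on_def)
  qed
  then have "(\<Sum>n. emeasure M1 (D n)) = (\<Sum>n. emeasure M2 (D n))" by simp
  then show ?thesis
    using suminf_emeasure[of D M1] suminf_emeasure[of D M2] Db dD uD sets by simp
qed

section \<open>Generic halfspaces and the geometry of the cone\<close>

text \<open>The vectors \<omega> / p parametrise the halfspaces with p < 0. If P failed throughout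
  \<open>V\<close>, the truncated cone over the exceptional set would contain a nonempty open set
  and could not be null.\<close>

lemma ae_halfspaces_dense:
  fixes V :: "'a::euclidean_space set"
  assumes P: "ae_halfspaces P" and V: "open V" "V \<noteq> {}"
  obtains \<omega> p where "norm \<omega> = 1" "p < 0" "P \<omega> p" "inverse p *\<^sub>R \<omega> \<in> V"
proof (rule ccontr)
  assume "\<not> thesis"
  with that have none: "\<not> P \<omega> p" if "norm \<omega> = 1" "p < 0" "inverse p *\<^sub>R \<omega> \<in> V" for \<omega> p
    using that by blast
  obtain N where N: "sphere_line_null N" "\<And>\<omega> p. \<omega> \<in> sphere 0 1 \<Longrightarrow> (\<omega>, p) \<notin> N \<Longrightarrow> P \<omega> p"
    using P unfolding ae_halfspaces_def by blast
  have "V \<noteq> {0}" using V(1) not_open_singleton by auto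
  then obtain v where v: "v \<in> V" "v \<noteq> 0" using V(2) by blast
  \<comment> \<open>\<open>?g\<close> sends a point (y, p) of the truncated cone to \<omega> / p
    with \<omega> = y / |y|. On \<open>?D\<close> the denominator is nonzero, so \<open>?g\<close>
    is continuous there.\<close>
  let ?g = "\<lambda>z::'a \<times> real. inverse (snd z * norm (fst z)) *\<^sub>R fst z"
  let ?D = "(ball 0 1 - {0}) \<times> {..<0} :: ('a \<times> real) set"
  define W where "W = ?D \<inter> ?g -` V"
  have "open W"
    unfolding W_def
    by (rule continuous_open_preimage) (auto intro!: continuous_intros open_Times V)
  moreover have "W \<noteq> {}"
  proof -
    \<comment> \<open>This point has |y| = 1/2 and p = -1 / |v|, and \<open>?g\<close> maps it to
      \<open>v\<close>.\<close>
    have "(- inverse (2 * norm v) *\<^sub>R v, - inverse (norm v)) \<in> W"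
      using v by (simp add: W_def field_simps)
    then show ?thesis by blast
  qed
  moreover have "negligible W"
  proof (rule negligible_subset)
    show "negligible (trunc_cone N)"
      using N(1) unfolding sphere_line_null_def negligible_iff_null_sets
      by (auto intro: null_sets_completionI)
    show "W \<subseteq> trunc_cone N"
    proof
      fix z assume z: "z \<in> W"
      obtain y p where yp: "z = (y, p)" by (cases z)
      have y: "y \<noteq> 0" "norm y < 1" "p < 0" "inverse (p * norm y) *\<^sub>R y \<in> V"
        using z yp by (auto simp: W_def)
      let ?\<omega> = "inverse (norm y) *\<^sub>R y"
      have "norm ?\<omega> = 1" "inverse p *\<^sub>R ?\<omega> \<in> V" using y by (simp_all add: mult.commute)
      then have "(?\<omega>, p) \<in> N" using none[of ?\<omega> p] y(3) N(2)[of ?\<omega> p] by auto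
      then have "(norm y *\<^sub>R ?\<omega>, p) \<in> trunc_cone N"
        unfolding trunc_cone_def using y
        by (intro image_eqI[of _ _ "(norm y, ?\<omega>, p)"]) auto
      then show "z \<in> trunc_cone N" using y yp by simp
    qed
  qed
  ultimately show False using open_not_negligible by blast
qed

text \<open>Division by the negative p reverses the inequality and leaves a single vector as
  parameter. The closure stays in x . \<omega> <= p, which excludes 0.\<close>

lemma halfspace_neg:
  fixes \<omega> :: "'a::euclidean_space"
  assumes "p < 0"
  shows "halfspace \<omega> p = {x. 1 < x \<bullet> (inverse p *\<^sub>R \<omega>)}"
    and "closure (halfspace \<omega> p) \<subseteq> UNIV - {0}"
proof -
  show "halfspace \<omega> p = {x. 1 < x \<bullet> (inverse p *\<^sub>R \<omega>)}"
    using assms by (auto simp: halfspace_def field_simps)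
  have "closed {x. x \<bullet> \<omega> \<le> p}" by (intro closed_Collect_le continuous_intros)
  then have "closure (halfspace \<omega> p) \<subseteq> {x. x \<bullet> \<omega> \<le> p}"
    by (intro closure_minimal) (auto simp: halfspace_def)
  then show "closure (halfspace \<omega> p) \<subseteq> UNIV - {0}" using assms by auto
qed

lemma inverse_norm_le_if_inner_gt_one:
  fixes x v :: "'a::real_inner"
  assumes "1 < x \<bullet> v"
  shows "inverse (norm v) \<le> norm x"
proof -
  have "v \<noteq> 0" using assms by auto
  have "1 \<le> norm x * norm v" using assms norm_cauchy_schwarz[of x v] by linarith
  then show "inverse (norm v) \<le> norm x" using \<open>v \<noteq> 0\<close> by (simp add: field_simps)
qed

text \<open>The functional attains a positive minimum on the compact slice of \<open>Q\<close> by
  the unit sphere, and homogeneity extends the bound to the cone. If the slice is empty,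
  \<open>Q\<close> has no nonzero point and any constant will do.\<close>

lemma cone_inner_bound:
  fixes Q :: "'a::euclidean_space set"
  assumes cone: "is_cone Q" and closedQ: "closed Q" and half: "\<forall>x\<in>Q - {0}. x \<bullet> \<omega>0 > 0"
  obtains c where "c > 0" "\<And>x. x \<in> Q \<Longrightarrow> c * norm x \<le> x \<bullet> \<omega>0"
proof (cases "Q \<inter> sphere 0 1 = {}")
  case True
  have "x = 0" if "x \<in> Q" for x
  proof (rule ccontr)
    assume "x \<noteq> 0"
    then have "inverse (norm x) *\<^sub>R x \<in> Q \<inter> sphere 0 1"
      using cone that unfolding is_cone_def by simp
    then show False using True by blast
  qed
  then show thesis using that[of 1] by fastforce
next
  case False
  have "compact (Q \<inter> sphere 0 1)" using closedQ by (intro closed_Int_compact) auto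
  then obtain u where u: "u \<in> Q \<inter> sphere 0 1" "\<And>x. x \<in> Q \<inter> sphere 0 1 \<Longrightarrow> u \<bullet> \<omega>0 \<le> x \<bullet> \<omega>0"
    using continuous_attains_inf[OF _ False, of "\<lambda>x. x \<bullet> \<omega>0"] continuous_on_inner[OF continuous_on_id continuous_on_const]
    by blast
  show thesis
  proof (rule that)
    show "u \<bullet> \<omega>0 > 0" using half u(1) by (metis DiffI IntE insert_iff empty_iff norm_zero mem_sphere_0 zero_neq_one)
    fix x assume x: "x \<in> Q"
    show "(u \<bullet> \<omega>0) * norm x \<le> x \<bullet> \<omega>0"
    proof (cases "x = 0")
      case False
      then have "inverse (norm x) *\<^sub>R x \<in> Q \<inter> sphere 0 1"
        using cone x unfolding is_cone_def by simp
      from u(2)[OF this] False show ?thesis by (simp add: field_simps)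
    qed simp
  qed
qed

lemma emeasure_distr_restricted:
  fixes M :: "'a::euclidean_space measure" and T :: "'a \<Rightarrow> 'b::euclidean_space"
  assumes "sets M = sets borel" "S \<in> sets borel" "T \<in> borel_measurable borel" "B \<in> sets borel"
  shows "emeasure (distr (density M (indicator S)) borel T) B = emeasure M (S \<inter> T -` B)"
proof -
  have T: "T \<in> measurable (density M (indicator S)) borel"
    using assms(1,3) by (simp add: measurable_cong_sets[OF assms(1) refl])
  have "T -` B \<in> sets borel" using measurable_sets[OF assms(3,4)] by simp
  moreover have "space M = UNIV" using sets_eq_imp_space_eq[OF assms(1)] by simp
  ultimately show ?thesis
    using T assms by (simp add: emeasure_distr emeasure_restricted)
qed

section \<open>Transfer of the measures to projective coordinates\<close>

theorem theorem4:
  fixes M1 M2 :: "'a::euclidean_space measure"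
    and Q :: "'a set" and \<omega>0 :: 'a
  assumes dim: "DIM('a) \<ge> 2"
    and sets1: "sets M1 = sets borel" and sets2: "sets M2 = sets borel"
    and fin1: "\<And>\<epsilon>. \<epsilon> > 0 \<Longrightarrow> emeasure M1 {x. \<epsilon> \<le> norm x} < \<infinity>"
    and fin2: "\<And>\<epsilon>. \<epsilon> > 0 \<Longrightarrow> emeasure M2 {x. \<epsilon> \<le> norm x} < \<infinity>"
    and cone: "is_cone Q" and closedQ: "closed Q"
    and \<omega>0: "\<omega>0 \<in> sphere 0 1" and halfQ: "\<forall>x\<in>Q - {0}. x \<bullet> \<omega>0 > 0"
    and supp: "signed_supp M1 M2 \<subseteq> Q"
    and hs: "ae_halfspaces (\<lambda>\<omega> p. closure (halfspace \<omega> p) \<subseteq> UNIV - {0} \<longrightarrow>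
                 emeasure M1 (halfspace \<omega> p) = emeasure M2 (halfspace \<omega> p))"
  shows "\<forall>A\<in>sets borel. A \<subseteq> UNIV - {0} \<and> away_from_0 A \<longrightarrow> emeasure M1 A = emeasure M2 A"
proof -
  define S where "S = Q - {0}"
  define H where "H v = {x :: 'a. 1 < x \<bullet> v}" for v
  have S: "S \<in> sets borel" using closedQ by (auto simp: S_def)
  have H: "H v \<in> sets borel" for v
    unfolding H_def by (intro borel_open open_Collect_less continuous_intros)
  have far: "{x :: 'a. \<epsilon> \<le> norm x} \<in> sets borel" for \<epsilon>
    by (intro borel_closed closed_Collect_le continuous_intros)
  have fin: "emeasure M1 A < \<infinity>" "emeasure M2 A < \<infinity>" if A: "away_from_0 A" for A
  proof -
    obtain \<epsilon> where e1: "\<epsilon> > 0" "\<forall>x\<in>A. \<epsilon> \<le> norm x"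
      using A unfolding away_from_0_def by blast
    then have e: "\<epsilon> > 0" "A \<subseteq> {x. \<epsilon> \<le> norm x}" by auto
    show "emeasure M1 A < \<infinity>" "emeasure M2 A < \<infinity>"
      using le_less_trans[OF emeasure_mono[OF e(2)] fin1[OF e(1)]]
        le_less_trans[OF emeasure_mono[OF e(2)] fin2[OF e(1)]] far by (simp_all only: sets1 sets2)
  qed
  have awayH: "away_from_0 (A \<inter> H v)" for A v
  proof (cases "v = 0")
    case True
    then show ?thesis unfolding away_from_0_def H_def by (intro exI[of _ 1]) simp
  next
    case False
    then show ?thesis
      unfolding away_from_0_def H_def by (intro exI[of _ "inverse (norm v)"]) (simp add: inverse_norm_le_if_inner_gt_one)
  qed
  obtain c where c: "c > 0" "\<And>x. x \<in> Q \<Longrightarrow> c * norm x \<le> x \<bullet> \<omega>0"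
    using cone_inner_bound[OF cone closedQ halfQ] by blast

  \<comment> \<open>Good normals are dense. The part of \<open>H v\<close> off \<open>S\<close> has
    equal finite masses by the support condition, so it can be subtracted from the equality for the
    whole halfspace.\<close>
  have good: "\<exists>v\<in>V. emeasure M1 (S \<inter> H v) = emeasure M2 (S \<inter> H v)" if V: "open V" "V \<noteq> {}" for V
  proof -
    obtain \<omega> p where p: "p < 0" "inverse p *\<^sub>R \<omega> \<in> V"
      and eq: "emeasure M1 (halfspace \<omega> p) = emeasure M2 (halfspace \<omega> p)"
      using ae_halfspaces_dense[OF hs V] halfspace_neg(2) by metis
    define v where "v = inverse p *\<^sub>R \<omega>"
    have eq: "emeasure M1 (H v) = emeasure M2 (H v)"
      using eq unfolding halfspace_neg(1)[OF p(1)] H_def v_def .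
    have aw: "away_from_0 (H v - S)"
      using awayH[of "- S" v] by (simp only: Diff_eq Int_commute)
    have "0 \<notin> H v" by (simp add: H_def)
    then have eq': "emeasure M1 (H v - S) = emeasure M2 (H v - S)"
      by (intro emeasure_eq_off_support[OF sets1 sets2 supp] aw sets.Diff H S) (auto simp: S_def)
    have "S \<inter> H v = H v - (H v - S)" by auto
    moreover have "emeasure M1 (H v - (H v - S)) = emeasure M1 (H v) - emeasure M1 (H v - S)"
      using fin(1)[OF aw] H S by (intro emeasure_Diff) (auto simp: sets1)
    moreover have "emeasure M2 (H v - (H v - S)) = emeasure M2 (H v) - emeasure M2 (H v - S)"
      using fin(2)[OF aw] H S by (intro emeasure_Diff) (auto simp: sets2)
    ultimately have "emeasure M1 (S \<inter> H v) = emeasure M2 (S \<inter> H v)"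
      by (simp only: eq eq')
    then show ?thesis using p(2) unfolding v_def by blast
  qed

  \<comment> \<open>Approximate \<open>v\<close> by good vectors \<open>u n\<close> close to \<open>v - d n *\<^sub>R \<omega>0\<close>: then \<open>S \<inter> H (u n)\<close> lies in
    \<open>S \<inter> H v\<close>, and the indicators converge at every point, even on the boundary of \<open>H v\<close>.\<close>
  have all: "emeasure M1 (S \<inter> H v) = emeasure M2 (S \<inter> H v)" for v
  proof -
    define d where "d n = inverse (real (Suc n))" for n
    have d: "d n > 0" for n by (simp add: d_def)
    have d0: "d \<longlonglongrightarrow> 0" unfolding d_def[abs_def] by (rule LIMSEQ_inverse_real_of_nat)
    have "\<exists>u \<in> ball (v - d n *\<^sub>R \<omega>0) (c * d n). emeasure M1 (S \<inter> H u) = emeasure M2 (S \<inter> H u)" for n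
      using good[of "ball (v - d n *\<^sub>R \<omega>0) (c * d n)"] c(1) d[of n] by (simp add: not_le)
    then obtain u where u: "\<And>n. u n \<in> ball (v - d n *\<^sub>R \<omega>0) (c * d n)"
      and ueq: "\<And>n. emeasure M1 (S \<inter> H (u n)) = emeasure M2 (S \<inter> H (u n))"
      by metis
    have un: "norm (u n - (v - d n *\<^sub>R \<omega>0)) < c * d n" for n
      using u[of n] by (simp add: dist_norm norm_minus_commute)
    \<comment> \<open>The radius \<open>c * d n\<close> is chosen so that, by the cone bound, the
      error x . (u n - v + d n \<omega>0) is smaller than the gain d n (x . \<omega>0) from the
      shift.\<close>
    have below: "x \<bullet> u n < x \<bullet> v" if x: "x \<in> S" for x n
    proof -
      have "x \<bullet> (u n - (v - d n *\<^sub>R \<omega>0)) \<le> norm x * norm (u n - (v - d n *\<^sub>R \<omega>0))"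
        by (rule norm_cauchy_schwarz)
      also have "\<dots> < norm x * (c * d n)"
        using x un by (intro mult_strict_left_mono) (auto simp: S_def)
      also have "\<dots> \<le> d n * (x \<bullet> \<omega>0)"
        using c(2)[of x] x d[of n] mult_left_mono[of "c * norm x" "x \<bullet> \<omega>0" "d n"]
        by (auto simp: S_def mult_ac)
      finally show ?thesis by (simp add: inner_simps)
    qed
    have "(\<lambda>n. u n - (v - d n *\<^sub>R \<omega>0)) \<longlonglongrightarrow> 0"
    proof (rule Lim_null_comparison)
      show "\<forall>\<^sub>F n in sequentially. norm (u n - (v - d n *\<^sub>R \<omega>0)) \<le> c * d n"
        using un by (auto intro!: always_eventually less_imp_le)
      show "(\<lambda>n. c * d n) \<longlonglongrightarrow> 0" using tendsto_mult_right_zero[OF d0] .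
    qed
    moreover have "(\<lambda>n. v - d n *\<^sub>R \<omega>0) \<longlonglongrightarrow> v - 0 *\<^sub>R \<omega>0"
      by (intro tendsto_intros d0)
    ultimately have "(\<lambda>n. (u n - (v - d n *\<^sub>R \<omega>0)) + (v - d n *\<^sub>R \<omega>0)) \<longlonglongrightarrow> 0 + (v - 0 *\<^sub>R \<omega>0)"
      by (rule tendsto_add)
    then have ulim: "u \<longlonglongrightarrow> v" by simp
    \<comment> \<open>The sets \<open>S \<inter> H (u n)\<close> need not be monotone in n, so
      dominated convergence is used, with the indicator of \<open>S \<inter> H v\<close> as the
      bound.\<close>
    have lim: "(\<lambda>n. measure M (S \<inter> H (u n))) \<longlonglongrightarrow> measure M (S \<inter> H v)"
      if M: "sets M = sets borel" "emeasure M (S \<inter> H v) < \<infinity>" for M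
    proof -
      have SH: "S \<inter> H w \<in> sets M" for w using S H M by auto
      have "(\<lambda>n. integral\<^sup>L M (indicator (S \<inter> H (u n)) :: _ \<Rightarrow> real)) \<longlonglongrightarrow> integral\<^sup>L M (indicator (S \<inter> H v))"
      proof (rule integral_dominated_convergence)
        show "integrable M (indicator (S \<inter> H v) :: _ \<Rightarrow> real)"
          using SH M(2) by (rule integrable_real_indicator)
        show "AE x in M. (\<lambda>n. indicator (S \<inter> H (u n)) x :: real) \<longlonglongrightarrow> indicator (S \<inter> H v) x"
        proof (rule AE_I2)
          fix x
          show "(\<lambda>n. indicator (S \<inter> H (u n)) x :: real) \<longlonglongrightarrow> indicator (S \<inter> H v) x"
          proof (cases "x \<in> S \<inter> H v")
            case True
            have "(\<lambda>n. x \<bullet> u n) \<longlonglongrightarrow> x \<bullet> v" by (intro tendsto_intros ulim)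
            then have "\<forall>\<^sub>F n in sequentially. 1 < x \<bullet> u n"
              using True by (intro order_tendstoD(1)) (auto simp: H_def)
            then have "\<forall>\<^sub>F n in sequentially. indicator (S \<inter> H (u n)) x = (1::real)"
              by eventually_elim (use True in \<open>auto simp: H_def\<close>)
            then show ?thesis using True by (simp add: tendsto_eventually)
          next
            case False
            then have "x \<notin> S \<inter> H (u n)" for n using below[of x n] by (auto simp: H_def)
            then show ?thesis using False by simp
          qed
        qed
        show "AE x in M. norm (indicator (S \<inter> H (u n)) x :: real) \<le> indicator (S \<inter> H v) x" for n
        proof (rule AE_I2)
          fix x show "norm (indicator (S \<inter> H (u n)) x :: real) \<le> indicator (S \<inter> H v) x"
            using below[of x n] by (auto simp: H_def indicator_def)
        qed
      qed (use SH in auto)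
      then show ?thesis using SH M(2) sets.sets_into_space[OF SH] by (simp add: Int_absorb2)
    qed
    have "measure M1 (S \<inter> H (u n)) = measure M2 (S \<inter> H (u n))" for n
      using ueq by (simp add: measure_def)
    then have "measure M1 (S \<inter> H v) = measure M2 (S \<inter> H v)"
      using lim[OF sets1 fin(1)[OF awayH]] lim[OF sets2 fin(2)[OF awayH]]
      by (auto intro: LIMSEQ_unique)
    then show ?thesis
      using fin[OF awayH[of S v]] by (simp add: emeasure_eq_ennreal_measure less_top)
  qed

  \<comment> \<open>This is x -> (t, w) with t = 1 / (x . \<omega>0) and w = t x. Its values matter
    only on \<open>S\<close>, where x . \<omega>0 > 0; \<open>P\<close> discards the rest through
    the density.\<close>
  define T where "T x = (inverse (x \<bullet> \<omega>0), inverse (x \<bullet> \<omega>0) *\<^sub>R x)" for x :: 'a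
  define P where "P M = distr (density M (indicator S)) borel T" for M :: "'a measure"
  have T: "T \<in> borel_measurable borel"
    unfolding T_def borel_prod[symmetric] by measurable
  have emP: "emeasure (P M) B = emeasure M (S \<inter> T -` B)"
    if "sets M = sets borel" "B \<in> sets borel" for M B
    unfolding P_def using that S T by (intro emeasure_distr_restricted)
  have Spos: "x \<bullet> \<omega>0 > 0" if "x \<in> S" for x using that halfQ by (auto simp: S_def)
  \<comment> \<open>For x in \<open>S\<close>, |w| = |x| / (x . \<omega>0) is at most 1 / c by the
    cone bound, which explains the radius.\<close>
  have AEP: "AE y in P M. y \<in> half_cylinder (inverse c)" if M: "sets M = sets borel" for M
  proof (rule AE_I)
    have cl: "closed (half_cylinder (inverse c) :: (real \<times> 'a) set)"
      unfolding half_cylinder_def by (intro closed_Times) auto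
    then have sb: "- half_cylinder (inverse c) \<in> sets (borel :: (real \<times> 'a) measure)" by auto
    show "- half_cylinder (inverse c) \<in> sets (P M)" using sb by (simp add: P_def)
    have "S \<inter> T -` (- half_cylinder (inverse c)) = {}"
      using Spos c by (fastforce simp: S_def T_def half_cylinder_def field_simps)
    then show "emeasure (P M) (- half_cylinder (inverse c)) = 0"
      by (simp add: emP[OF M sb])
  qed auto
  \<comment> \<open>The condition t < b means x . \<omega>0 > 1 / b and hence |x| >= 1 / b: finite
    mass away from the origin becomes finite mass below each level of t.\<close>
  have awayT: "away_from_0 (S \<inter> T -` {y. fst y < b})" for b
  proof (cases "b > 0")
    case True
    have "inverse b \<le> norm x" if x: "x \<in> S" "inverse (x \<bullet> \<omega>0) < b" for x
    proof -
      have "inverse b \<le> x \<bullet> \<omega>0" using Spos[OF x(1)] x(2) True by (simp add: field_simps)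
      also have "\<dots> \<le> norm x" using norm_cauchy_schwarz[of x \<omega>0] \<omega>0 by simp
      finally show ?thesis .
    qed
    then show ?thesis using True
      unfolding away_from_0_def T_def by (intro exI[of _ "inverse b"]) simp
  next
    case False
    have "\<not> inverse (x \<bullet> \<omega>0) < b" if "x \<in> S" for x
      using False positive_imp_inverse_positive[OF Spos[OF that]] by linarith
    then have "S \<inter> T -` {y. fst y < b} = {}"
      by (auto simp: T_def)
    then show ?thesis unfolding away_from_0_def by (intro exI[of _ 1]) simp
  qed
  have "cylinder_pair (P M1) (P M2) (inverse c)"
  proof
    show "sets (P M1) = sets borel" "sets (P M2) = sets borel" by (simp_all add: P_def)
    show "AE y in P M1. y \<in> half_cylinder (inverse c)" "AE y in P M2. y \<in> half_cylinder (inverse c)"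
      using AEP sets1 sets2 by auto
    show "emeasure (P M1) {y. fst y < b} < \<infinity>" "emeasure (P M2) {y. fst y < b} < \<infinity>" for b
      using fin[OF awayT[of b]] by (simp_all only: emP sets1 sets2 below_borel)
    fix a z
    have "{y :: real \<times> 'a. fst y < a + snd y \<bullet> z} \<in> sets borel"
      by (intro borel_open open_Collect_less continuous_intros)
    \<comment> \<open>Multiplying t < a + w . z by the positive number x . \<omega>0 gives 1 < x .
      (a \<omega>0 + z).\<close>
    moreover have "S \<inter> T -` {y. fst y < a + snd y \<bullet> z} = S \<inter> H (a *\<^sub>R \<omega>0 + z)"
      using Spos by (force simp: T_def H_def inner_simps field_simps)
    ultimately show "emeasure (P M1) {y. fst y < a + snd y \<bullet> z} = emeasure (P M2) {y. fst y < a + snd y \<bullet> z}"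
      by (simp only: emP sets1 sets2 all)
  qed
  then have PP: "P M1 = P M2" by (rule cylinder_pair.measures_equal)

  show ?thesis
  proof (intro ballI impI)
    fix A :: "'a set" assume A: "A \<in> sets borel" "A \<subseteq> UNIV - {0} \<and> away_from_0 A"
    \<comment> \<open>The map (t, w) -> w / t inverts \<open>T\<close> on \<open>S\<close>, so the
      preimage of \<open>B\<close> recovers the part of \<open>A\<close> in \<open>S\<close>; the
      part outside \<open>S\<close> is covered by the support condition, as \<open>A\<close> omits
      0.\<close>
    define B where "B = {y :: real \<times> 'a. inverse (fst y) *\<^sub>R snd y \<in> A}"
    have "(\<lambda>y :: real \<times> 'a. inverse (fst y) *\<^sub>R snd y) \<in> borel_measurable borel"
      unfolding borel_prod[symmetric] by measurable
    from measurable_sets[OF this A(1)] have B: "B \<in> sets borel"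
      by (simp add: B_def vimage_def)
    have "S \<inter> T -` B = A \<inter> S"
      using Spos by (force simp: B_def T_def)
    then have "emeasure M1 (A \<inter> S) = emeasure M2 (A \<inter> S)"
      using emP[OF sets1 B] emP[OF sets2 B] PP by simp
    moreover have "emeasure M1 (A - S) = emeasure M2 (A - S)"
      using A S by (intro emeasure_eq_off_support[OF sets1 sets2 supp])
        (auto simp: S_def away_from_0_def)
    moreover have "emeasure M A = emeasure M (A \<inter> S) + emeasure M (A - S)" if "sets M = sets borel" for M
      using A S that by (subst plus_emeasure) (auto intro!: arg_cong[where f="emeasure M"])
    ultimately show "emeasure M1 A = emeasure M2 A" using sets1 sets2 by simp
  qed
qed

end
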